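(* Let $n\geq 0$, $r\geq 1$, $p\geq 2$ be integers, and let $S$ be an $n$-element set. Suppose $\mathcal{M}$ is a class (set) of weak compositions of $S$ into $p$ parts such that, for each $k$ with $1\leq k<p$, the family $\mathcal{M}_k=\{A_k : (A_1,\ldots,A_p)\in\mathcal{M}\}$ of distinct $k$-th parts of members of $\mathcal{M}$ is $r$-chain-free. Then (a) $\displaystyle \sum_{A=(A_1,\ldots,A_p)\in \mathcal{M}} \frac{1}{\binom{n}{|A_1|,\ldots,|A_p|}} \leq r^{p-1}$, and (b) $|\mathcal{M}|$ is bounded above by the sum of the $r^{p-1}$ largest $p$-multinomial coefficients for $n$.
   Context: A chain of sets is a class of mutually comparable sets $T\subset T'\subset\cdots\subset T^{(l)}$ (strict inclusions); its length is $l$, so a chain of length $l$ has $l+1$ members. A class $\mathcal{A}$ of subsets of $S$ is $r$-chain-free if it contains no chain of length $r$, i.e. no $r+1$ distinct members of $\mathcal{A}$ are mutually comparable under inclusion (so $1$-chain-free means antichain). A weak composition of $S$ into $p$ parts is an ordered $p$-tuple $A=(A_1,\ldots,A_p)$ of pairwise disjoint subsets of $S$ whose union is $S$; parts may be empty. $A_k$ is called the $k$-th part of $A$. A $p$-multinomial coefficient for $n$ is a multinomial coefficient $\binom{n}{a_1,\ldots,a_p}=\frac{n!}{a_1!\cdots a_p!}$, where $a_1,\ldots,a_p$ are nonnegative integers with $a_1+\cdots+a_p=n$. These are counted with multiplicity, one for each ordered $p$-tuple $(a_1,\ldots,a_p)$, so there are $\binom{n+p-1}{p-1}$ of them. The "$r^{p-1}$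 largest" means the first $r^{p-1}$ terms when they are listed (with multiplicity) in weakly decreasing order; if $r^{p-1}$ exceeds $\binom{n+p-1}{p-1}$, the list is extended with zeros. *)

theory Defs
  imports Complex_Main "HOL-Library.Multiset" "HOL-Library.Disjoint_Sets"
begin

text \<open>A chain of length \<open>l\<close> has \<open>l + 1\<close> members; \<open>card C = Suc l\<close> also forces \<open>C\<close> to be finite.\<close>

definition chain_of_length :: "'a set set \<Rightarrow> nat \<Rightarrow> 'a set set \<Rightarrow> bool" where
  "chain_of_length \<A> l C \<longleftrightarrow> subset.chain \<A> C \<and> card C = Suc l"

definition chain_free :: "nat \<Rightarrow> 'a set set \<Rightarrow> bool" where
  "chain_free r \<A> \<longleftrightarrow> \<not> (\<exists>C. chain_of_length \<A> r C)"

text \<open>Ordered \<open>p\<close>-tuples are lists of length \<open>p\<close>. Disjointness is by position, so the empty set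
  may occur as several parts.\<close>

definition weak_compositions :: "'a set \<Rightarrow> nat \<Rightarrow> 'a set list set" where
  "weak_compositions S p =
     {A. length A = p \<and> disjoint_family_on (\<lambda>i. A ! i) {..<p} \<and> \<Union> (set A) = S}"

text \<open>Parts are numbered from 1, list positions from 0.\<close>

definition part :: "nat \<Rightarrow> 'a set list \<Rightarrow> 'a set" where
  "part k A = A ! (k - 1)"

definition multinomial :: "nat \<Rightarrow> nat list \<Rightarrow> nat" where
  "multinomial n as = fact n div prod_list (map fact as)"

definition weak_int_compositions :: "nat \<Rightarrow> nat \<Rightarrow> nat list set" where
  "weak_int_compositions n p = {as. length as = p \<and> sum_list as = n}"

definition multinomials_desc :: "nat \<Rightarrow> nat \<Rightarrow> nat list" where
  "multinomials_desc n p =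
     rev (sorted_list_of_multiset
       (image_mset (multinomial n) (mset_set (weak_int_compositions n p))))"

text \<open>If \<open>N\<close> exceeds the length of the list, \<open>take\<close> returns the whole list, which gives the same
  sum as extending the list with zeros.\<close>

definition sum_largest_multinomials :: "nat \<Rightarrow> nat \<Rightarrow> nat \<Rightarrow> nat" where
  "sum_largest_multinomials N n p = sum_list (take N (multinomials_desc n p))"

text \<open>The division in \<^const>\<open>multinomial\<close> is exact, and \<^const>\<open>mset_set\<close> is applied to a finite set
  above.\<close>

lemma prod_list_fact_dvd_fact: "prod_list (map fact as) dvd (fact (sum_list as) :: nat)"
proof (induction as)
  case (Cons a as)
  have "fact a * prod_list (map fact as) dvd (fact a * fact (sum_list as) :: nat)"
    using Cons by (rule mult_dvd_mono[OF dvd_refl])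
  also have "\<dots> dvd fact (a + sum_list as)"
    by (rule fact_fact_dvd_fact)
  finally show ?case by simp
qed simp

lemma finite_weak_int_compositions: "finite (weak_int_compositions n p)"
proof (rule finite_subset)
  show "weak_int_compositions n p \<subseteq> {as. set as \<subseteq> {..n} \<and> length as = p}"
    by (auto simp: weak_int_compositions_def dest: member_le_sum_list)
  show "finite {as. set as \<subseteq> {..n} \<and> length as = p}"
    by (rule finite_lists_length_eq) simp
qed

lemma length_multinomials_desc:
  assumes "p \<ge> 1"
  shows "length (multinomials_desc n p) = (n + p - 1) choose (p - 1)"
proof -
  have "length (multinomials_desc n p) = card (weak_int_compositions n p)"
    unfolding multinomials_desc_def
    by (metis length_rev mset_sorted_list_of_multiset size_image_mset size_mset size_mset_set)
  also have "\<dots> = (n + p - 1) choose n"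
    unfolding weak_int_compositions_def by (rule card_length_sum_list)
  also have "\<dots> = (n + p - 1) choose (p - 1)"
    using assms by (subst binomial_symmetric) auto
  finally show ?thesis .
qed

end

theory Submission
  imports Defs
begin

text \<open>Averaging over the subsets \<open>S - {x}\<close> proves the LYM inequality for chain-free families by
  induction on \<open>card S\<close>. Splitting off the first part, \<open>multinomial n (a # as)\<close> factors as
  \<open>(n choose a) * multinomial (n - a) as\<close>, and the LYM inequality applied to the first parts gives (a)
  by induction on the number of parts. The compositions with prescribed part sizes form a class whose
  part families are antichains, so (a) with \<open>r = 1\<close> shows that \<open>\<M>\<close> contains a fraction
  \<open>x as \<le> 1\<close> of \<open>multinomial n as\<close> compositions of type \<open>as\<close>; the fractions sum to at most
  \<open>r ^ (p - 1)\<close> by (a), and (b) is the resulting fractional knapsack bound.\<close>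

section \<open>Chain-free families and the LYM inequality\<close>

lemma chain_free_subset:
  assumes "chain_free r \<G>" and "\<F> \<subseteq> \<G>"
  shows "chain_free r \<F>"
  using assms by (auto simp: chain_free_def chain_of_length_def subset_chain_def)

text \<open>The set \<open>S\<close> is comparable with every member of \<open>\<F>\<close>, so it
  extends any chain in \<open>\<F> - {S}\<close> by one. Hence discarding it lowers the admissible
  chain length by one, and \<open>r = 0\<close> is impossible because \<open>{S}\<close> alone is a
  chain of length 0.\<close>

lemma chain_free_remove_top:
  assumes "chain_free r \<F>" and "S \<in> \<F>" and "\<F> \<subseteq> Pow S"
  shows "\<exists>r'. r = Suc r' \<and> chain_free r' (\<F> - {S})"
proof (cases r)
  case 0
  have "chain_of_length \<F> 0 {S}"
    using assms by (auto simp: chain_of_length_def subset_chain_def)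
  with assms 0 show ?thesis by (auto simp: chain_free_def)
next
  case (Suc r')
  have "chain_free r' (\<F> - {S})"
    unfolding chain_free_def
  proof
    assume "\<exists>C. chain_of_length (\<F> - {S}) r' C"
    then obtain C where C: "C \<subseteq> \<F> - {S}" "card C = Suc r'"
      "\<And>X Y. X \<in> C \<Longrightarrow> Y \<in> C \<Longrightarrow> X \<subseteq> Y \<or> Y \<subseteq> X"
      by (auto simp: chain_of_length_def subset_chain_def)
    have "finite C" using C(2) by (metis card.infinite nat.distinct(1))
    then have "card (insert S C) = Suc r"
      using C Suc by (subst card_insert_disjoint) auto
    moreover have "X \<subseteq> S" if "X \<in> C" for X using that C(1) assms(3) by blast
    ultimately have "chain_of_length \<F> r (insert S C)"
      using C assms(2) by (auto simp: chain_of_length_def subset_chain_def)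
    with assms(1) show False by (auto simp: chain_free_def)
  qed
  with Suc show ?thesis by blast
qed

lemma chain_free_1_if_card_eq:
  assumes "\<And>A. A \<in> \<F> \<Longrightarrow> finite A \<and> card A = a"
  shows "chain_free 1 \<F>"
  unfolding chain_free_def
proof
  assume "\<exists>C. chain_of_length \<F> 1 C"
  then obtain C where C: "C \<subseteq> \<F>" "card C = 2"
    "\<And>X Y. X \<in> C \<Longrightarrow> Y \<in> C \<Longrightarrow> X \<subseteq> Y \<or> Y \<subseteq> X"
    by (auto simp: chain_of_length_def subset_chain_def)
  obtain X Y where XY: "C = {X, Y}" "X \<noteq> Y" using C(2) by (auto simp: card_2_iff)
  have "finite X" "finite Y" "card X = card Y" using C(1) XY assms by auto
  moreover have "X \<subseteq> Y \<or> Y \<subseteq> X" using C(3) XY by auto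
  ultimately show False using XY(2) card_subset_eq by metis
qed

text \<open>The first factor is the proportion of points of an \<open>Suc m\<close>-set lying
  outside a given \<open>k\<close>-subset. The identity thus turns the LYM weight of a proper subset
  into an average over one-point deletions.\<close>

lemma inverse_binomial_Suc:
  assumes "k \<le> m"
  shows "1 / real (Suc m choose k) = real (Suc m - k) / real (Suc m) * (1 / real (m choose k))"
proof -
  have "(Suc m - k) * (Suc m choose k) = Suc m * (m choose k)"
    using binomial_absorb_comp[of "Suc m" k] by simp
  then have "real (Suc m - k) * real (Suc m choose k) = real (Suc m) * real (m choose k)"
    by (metis of_nat_mult)
  moreover have "real (Suc m choose k) > 0" "real (m choose k) > 0" using assms by simp_all
  ultimately show ?thesis by (simp add: field_simps del: of_nat_Suc binomial_Suc_Suc)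
qed

text \<open>Averaging handles proper subsets of \<open>S\<close> only, since \<open>S\<close>
  survives no deletion of a point. If \<open>S\<close> belongs to \<open>\<F>\<close>, it is split
  off first: it has weight 1, and its removal lowers \<open>r\<close> by one.\<close>

lemma chain_free_LYM:
  assumes "finite S" and "\<F> \<subseteq> Pow S" and "chain_free r \<F>"
  shows "(\<Sum>A\<in>\<F>. 1 / real (card S choose card A)) \<le> real r"
  using assms
proof (induction "card S" arbitrary: S \<F> r)
  case 0
  then have S: "S = {}" by simp
  show ?case
  proof (cases "S \<in> \<F>")
    case True
    then have "\<F> = {S}" using 0 S by auto
    moreover have "r \<ge> 1" using chain_free_remove_top[OF 0(4) True 0(3)] by auto
    ultimately show ?thesis using S by simp
  next
    case False
    then have "\<F> = {}" using 0 S by auto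
    then show ?thesis by simp
  qed
next
  case (Suc m)
  have proper: "(\<Sum>A\<in>\<G>. 1 / real (card S choose card A)) \<le> real q"
    if \<G>: "\<G> \<subseteq> Pow S" "S \<notin> \<G>" "chain_free q \<G>" for \<G> q
  proof -
    have fin: "finite \<G>" using \<G>(1) Suc.prems(1) by (meson finite_Pow_iff finite_subset)
    \<comment> \<open>Each \<open>x\<close> outside \<open>A\<close> contributes the weight that
      \<open>A\<close> has as a subset of \<open>S - {x}\<close>.\<close>
    have "1 / real (card S choose card A)
        = (\<Sum>x | x \<in> S \<and> x \<notin> A. 1 / real (m choose card A)) / real (card S)" if "A \<in> \<G>" for A
    proof -
      have A: "A \<subset> S" using that \<G> by blast
      then have "card A \<le> m"
        using psubset_card_mono[OF Suc.prems(1) A] Suc.hyps(2) by simp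
      moreover have "card {x \<in> S. x \<notin> A} = card S - card A"
        using card_Diff_subset[of A S] A Suc.prems(1) finite_subset[of A S]
        by (simp add: set_diff_eq psubset_imp_subset)
      ultimately show ?thesis
        using inverse_binomial_Suc[of "card A" m] Suc.hyps(2) by simp
    qed
    then have "(\<Sum>A\<in>\<G>. 1 / real (card S choose card A))
        = (\<Sum>A\<in>\<G>. \<Sum>x | x \<in> S \<and> x \<notin> A. 1 / real (m choose card A)) / real (card S)"
      by (simp add: sum_divide_distrib)
    also have "(\<Sum>A\<in>\<G>. \<Sum>x | x \<in> S \<and> x \<notin> A. 1 / real (m choose card A))
        = (\<Sum>x\<in>S. \<Sum>A | A \<in> \<G> \<and> x \<notin> A. 1 / real (m choose card A))"
      using fin Suc.prems(1) by (rule sum.swap_restrict)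
    \<comment> \<open>For fixed \<open>x\<close> the inner sum is the LYM sum of a subfamily living
      in \<open>S - {x}\<close>, so the induction hypothesis applies with the same
      \<open>q\<close>.\<close>
    also have "\<dots> \<le> (\<Sum>x\<in>S. real q)"
    proof (rule sum_mono)
      fix x assume x: "x \<in> S"
      then have "m = card (S - {x})" using Suc by simp
      moreover have "chain_free q {A \<in> \<G>. x \<notin> A}"
        using \<G>(3) by (rule chain_free_subset) auto
      ultimately show "(\<Sum>A | A \<in> \<G> \<and> x \<notin> A. 1 / real (m choose card A)) \<le> real q"
        using Suc.hyps(1)[of "S - {x}" "{A \<in> \<G>. x \<notin> A}" q] Suc.prems(1) \<G>(1) by blast
    qed
    finally show ?thesis using Suc.hyps(2) by (simp add: field_simps del: of_nat_Suc)
  qed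
  show ?case
  proof (cases "S \<in> \<F>")
    case True
    have fin: "finite \<F>" using Suc.prems by (meson finite_Pow_iff finite_subset)
    obtain r' where r': "r = Suc r'" "chain_free r' (\<F> - {S})"
      using chain_free_remove_top[OF Suc.prems(3) True Suc.prems(2)] by blast
    have "(\<Sum>A\<in>\<F> - {S}. 1 / real (card S choose card A)) \<le> real r'"
      using Suc.prems(2) r'(2) by (intro proper) auto
    then show ?thesis using r'(1) by (simp add: sum.remove[OF fin True])
  next
    case False
    then show ?thesis using Suc.prems by (intro proper)
  qed
qed

section \<open>Weak compositions, split at the first part\<close>

lemma weak_compositions_0: "weak_compositions S 0 = (if S = {} then {[]} else {})"
  by (auto simp: weak_compositions_def disjoint_family_on_def)

lemma Cons_in_weak_compositions_iff:
  "B # A \<in> weak_compositions S (Suc p) \<longleftrightarrow> B \<subseteq> S \<and> A \<in> weak_compositions (S - B) p"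
proof -
  have "disjoint_family_on (\<lambda>i. (B # A) ! i) {..<Suc p} \<longleftrightarrow>
      disjoint_family_on (\<lambda>i. A ! i) {..<p} \<and> (\<forall>i<p. B \<inter> A ! i = {})"
    unfolding disjoint_family_on_def lessThan_iff all_simps Ball_def
    by (simp add: All_less_Suc2 Int_commute) blast
  moreover have "(\<forall>i<p. B \<inter> A ! i = {}) \<longleftrightarrow> B \<inter> \<Union> (set A) = {}" if "length A = p"
    using that by (auto simp: set_conv_nth)
  ultimately show ?thesis by (auto simp: weak_compositions_def)
qed

lemma weak_compositions_cases:
  assumes "A \<in> weak_compositions S (Suc p)"
  obtains B A' where "A = B # A'" "B \<subseteq> S" "A' \<in> weak_compositions (S - B) p"
proof (cases A)
  case Nil
  then show thesis using assms by (simp add: weak_compositions_def)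
next
  case (Cons B A')
  then show thesis using assms that by (simp add: Cons_in_weak_compositions_iff)
qed

lemma finite_weak_compositions:
  assumes "finite S"
  shows "finite (weak_compositions S p)"
proof (rule finite_subset)
  show "weak_compositions S p \<subseteq> {A. set A \<subseteq> Pow S \<and> length A = p}"
    by (auto simp: weak_compositions_def)
  show "finite {A. set A \<subseteq> Pow S \<and> length A = p}"
    using assms by (intro finite_lists_length_eq) simp
qed

lemma map_card_in_weak_int_compositions:
  assumes "finite S" and "A \<in> weak_compositions S p"
  shows "map card A \<in> weak_int_compositions (card S) p"
  using assms
proof (induction p arbitrary: A S)
  case 0
  then show ?case by (auto simp: weak_compositions_0 weak_int_compositions_def split: if_splits)
next
  case (Suc p)
  from Suc.prems(2) obtain B A' where A: "A = B # A'" "B \<subseteq> S" "A' \<in> weak_compositions (S - B) p"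
    by (rule weak_compositions_cases)
  have "map card A' \<in> weak_int_compositions (card (S - B)) p"
    using A(3) Suc by blast
  moreover have "card (S - B) = card S - card B" "card B \<le> card S"
    using A(2) Suc.prems(1) by (simp_all add: card_Diff_subset finite_subset card_mono)
  ultimately show ?case using A(1) by (simp add: weak_int_compositions_def)
qed

section \<open>Multinomial coefficients and the weighted bound (a)\<close>

lemma multinomial_pos:
  assumes "sum_list as = n"
  shows "multinomial n as > 0"
proof -
  have "prod_list (map fact as) \<le> (fact n :: nat)"
    using prod_list_fact_dvd_fact[of as] assms by (auto intro: dvd_imp_le)
  moreover have "prod_list (map fact as) > (0::nat)" by (induction as) auto
  ultimately show ?thesis by (simp add: multinomial_def div_greater_zero_iff)
qed

text \<open>Since \<open>multinomial\<close> uses division on \<open>nat\<close>, the factorization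
  rests on exactness: the witness \<open>d\<close> is the quotient that becomes
  \<open>multinomial (n - a) as\<close>.\<close>

lemma multinomial_Cons:
  assumes "a + sum_list as = n"
  shows "multinomial n (a # as) = (n choose a) * multinomial (n - a) as"
proof -
  obtain d where d: "fact (n - a) = prod_list (map fact as) * (d::nat)"
    using prod_list_fact_dvd_fact[of as] assms by (metis dvdE diff_add_inverse)
  have pos: "prod_list (map fact as) > (0::nat)" by (induction as) auto
  have "fact n = fact a * fact (n - a) * (n choose a)"
    using binomial_fact_lemma[of a n] assms by simp
  then show ?thesis using d pos by (simp add: multinomial_def algebra_simps)
qed

text \<open>The exponent \<open>q\<close> counts the parts under a chain condition; the last part is
  the complement of their union. The induction therefore starts with the single composition
  \<open>[S]\<close>.\<close>

lemma sum_inverse_multinomial_le: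
  assumes "finite S" and "\<M> \<subseteq> weak_compositions S (Suc q)"
    and "\<And>i. i < q \<Longrightarrow> chain_free r ((\<lambda>A. A ! i) ` \<M>)"
  shows "(\<Sum>A\<in>\<M>. 1 / real (multinomial (card S) (map card A))) \<le> real r ^ q"
  using assms
proof (induction q arbitrary: S \<M>)
  case 0
  have "\<M> \<subseteq> {[S]}"
  proof
    fix A assume "A \<in> \<M>"
    then have "A \<in> weak_compositions S (Suc 0)" using 0(2) by blast
    then show "A \<in> {[S]}"
    proof (rule weak_compositions_cases)
      fix B A' assume "A = B # A'" "B \<subseteq> S" "A' \<in> weak_compositions (S - B) 0"
      then show "A \<in> {[S]}" by (simp add: weak_compositions_0 split: if_splits)
    qed
  qed
  then have "\<M> = {} \<or> \<M> = {[S]}" by (rule subset_singletonD)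
  moreover have "multinomial (card S) [card S] = 1" by (simp add: multinomial_def)
  ultimately show ?case by (elim disjE) simp_all
next
  case (Suc q)
  define \<N> where "\<N> B = {A. B # A \<in> \<M>}" for B
  define \<B> where "\<B> = (\<lambda>A. A ! 0) ` \<M>"
  have fin: "finite \<M>"
    by (rule finite_subset[OF Suc.prems(2) finite_weak_compositions[OF Suc.prems(1)]])
  have \<N>: "B \<subseteq> S \<and> A \<in> weak_compositions (S - B) (Suc q)" if "A \<in> \<N> B" for A B
    using that Suc.prems(2) by (auto simp: \<N>_def simp flip: Cons_in_weak_compositions_iff)
  have fin\<N>: "finite (\<N> B)" for B
  proof (rule finite_subset)
    show "\<N> B \<subseteq> tl ` \<M>" by (auto simp: \<N>_def intro: rev_image_eqI)
  qed (use fin in simp)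
  have \<B>: "\<B> \<subseteq> Pow S"
  proof
    fix B assume "B \<in> \<B>"
    then obtain A where "A \<in> weak_compositions S (Suc (Suc q))" "B = A ! 0"
      using Suc.prems(2) by (auto simp: \<B>_def)
    then show "B \<in> Pow S" by (auto simp: weak_compositions_def)
  qed
  \<comment> \<open>Fixing the first part \<open>B\<close> leaves compositions of
    \<open>S - B\<close> whose \<open>i\<close>-th entries are among the entries of
    \<open>\<M>\<close> at position \<open>Suc i\<close>, so chain-freeness is inherited with the
    same \<open>r\<close>.\<close>
  have tail: "(\<Sum>A\<in>\<N> B. 1 / real (multinomial (card (S - B)) (map card A))) \<le> real r ^ q" for B
  proof (rule Suc.IH)
    show "chain_free r ((\<lambda>A. A ! i) ` \<N> B)" if "i < q" for i
    proof (rule chain_free_subset)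
      show "chain_free r ((\<lambda>A. A ! Suc i) ` \<M>)" using Suc.prems(3) that by simp
      show "(\<lambda>A. A ! i) ` \<N> B \<subseteq> (\<lambda>A. A ! Suc i) ` \<M>"
        by (auto simp: \<N>_def intro: rev_image_eqI)
    qed
  qed (use Suc.prems(1) \<N> in auto)
  have factor: "1 / real (multinomial (card S) (map card (B # A)))
      = 1 / real (card S choose card B) * (1 / real (multinomial (card (S - B)) (map card A)))"
    if "A \<in> \<N> B" for A B
  proof -
    have "sum_list (map card A) = card (S - B)"
      using map_card_in_weak_int_compositions[of "S - B" A "Suc q"] \<N>[OF that] Suc.prems(1)
      by (simp add: weak_int_compositions_def)
    moreover have "card (S - B) = card S - card B" "card B \<le> card S"
      using \<N>[OF that] Suc.prems(1) by (auto simp: card_Diff_subset finite_subset card_mono)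
    ultimately show ?thesis by (simp add: multinomial_Cons)
  qed
  have "(\<Sum>A\<in>\<M>. 1 / real (multinomial (card S) (map card A)))
      = (\<Sum>(B, A)\<in>Sigma \<B> \<N>. 1 / real (multinomial (card S) (map card (B # A))))"
  proof (rule sum.reindex_bij_witness[where i = "\<lambda>(B, A). B # A" and j = "\<lambda>A. (A ! 0, tl A)"])
    fix A assume A: "A \<in> \<M>"
    then have "A \<in> weak_compositions S (Suc (Suc q))" using Suc.prems(2) by blast
    then obtain B A' where "A = B # A'" by (rule weak_compositions_cases)
    with A show "(case (A ! 0, tl A) of (B, A) \<Rightarrow> B # A) = A" "(A ! 0, tl A) \<in> Sigma \<B> \<N>"
      "(case (A ! 0, tl A) of (B, A) \<Rightarrow> 1 / real (multinomial (card S) (map card (B # A))))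
        = 1 / real (multinomial (card S) (map card A))"
      by (auto simp: \<B>_def \<N>_def intro: rev_image_eqI)
  qed (auto simp: \<N>_def)
  also have "\<dots> = (\<Sum>B\<in>\<B>. \<Sum>A\<in>\<N> B. 1 / real (multinomial (card S) (map card (B # A))))"
    using fin fin\<N> by (subst sum.Sigma) (auto simp: \<B>_def)
  also have "\<dots> = (\<Sum>B\<in>\<B>. 1 / real (card S choose card B)
      * (\<Sum>A\<in>\<N> B. 1 / real (multinomial (card (S - B)) (map card A))))"
    by (simp only: factor sum_distrib_left cong: sum.cong)
  \<comment> \<open>The bound on the tails is uniform in \<open>B\<close>; what remains is the LYM
    sum of the first parts, which supplies the last factor \<open>r\<close>.\<close>
  also have "\<dots> \<le> (\<Sum>B\<in>\<B>. 1 / real (card S choose card B) * real r ^ q)"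
    by (intro sum_mono mult_left_mono tail) simp
  also have "\<dots> = (\<Sum>B\<in>\<B>. 1 / real (card S choose card B)) * real r ^ q"
    by (simp add: sum_distrib_right)
  also have "\<dots> \<le> real r * real r ^ q"
    using chain_free_LYM[OF Suc.prems(1) \<B>] Suc.prems(3)[of 0]
    by (intro mult_right_mono) (auto simp: \<B>_def)
  finally show ?case by simp
qed

section \<open>Sums of the largest terms and the cardinality bound (b)\<close>

text \<open>Here \<open>x t\<close> is the fraction taken of an item of value \<open>f t\<close>,
  and \<open>N\<close> is the capacity. No fractional choice beats taking the \<open>N\<close> most
  valuable items whole.\<close>

lemma fractional_knapsack_le:
  fixes f :: "'b \<Rightarrow> nat" and x :: "'b \<Rightarrow> real"
  assumes "finite T" and x: "\<And>t. t \<in> T \<Longrightarrow> 0 \<le> x t \<and> x t \<le> 1" and N: "sum x T \<le> real N"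
  shows "(\<Sum>t\<in>T. x t * real (f t))
    \<le> real (sum_list (take N (rev (sorted_list_of_multiset (image_mset f (mset_set T))))))"
proof -
  define L where "L = rev (sorted_list_of_multiset (image_mset f (mset_set T)))"
  have mset_L: "mset L = image_mset f (mset_set T)" by (simp add: L_def)
  have sum_L: "sum_list (map g L) = (\<Sum>t\<in>T. g (f t))" for g :: "nat \<Rightarrow> real"
  proof -
    have "sum_list (map g L) = sum_mset (image_mset g (mset L))"
      by (metis mset_map sum_mset_sum_list)
    also have "\<dots> = (\<Sum>t\<in>T. g (f t))"
      by (simp add: mset_L image_mset.compositionality comp_def sum_unfold_sum_mset)
    finally show ?thesis .
  qed
  have desc: "L ! j \<le> L ! i" if "i \<le> j" "j < length L" for i j
    using that sorted_rev_nth_mono[of L i j] by (simp add: L_def)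
  show ?thesis
  proof (cases "length L \<le> N")
    \<comment> \<open>Here \<open>take N L\<close> is all of \<open>L\<close>, so
      \<open>x t \<le> 1\<close> gives the bound termwise.\<close>
    case True
    have "(\<Sum>t\<in>T. x t * real (f t)) \<le> (\<Sum>t\<in>T. real (f t))"
      using x by (intro sum_mono) (simp add: mult_left_le_one_le)
    also have "\<dots> = real (sum_list L)" using sum_L[of real] by (simp flip: sum_list_of_nat)
    finally show ?thesis using True by (simp add: L_def)
  next
    case False
    \<comment> \<open>Lagrangian duality, with the first item left out as the price.\<close>
    define c where "c = real (L ! N)"
    have "(\<Sum>t\<in>T. x t * real (f t)) = (\<Sum>t\<in>T. x t * (real (f t) - c)) + c * sum x T"
      by (simp add: algebra_simps sum_subtractf sum_distrib_left)
    \<comment> \<open>An item above the price \<open>c\<close> gains from raising \<open>x t\<close>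
      to 1, any other from lowering it to 0. The capacity bound is multiplied by \<open>c\<close>,
      which is nonnegative.\<close>
    also have "\<dots> \<le> (\<Sum>t\<in>T. max 0 (real (f t) - c)) + c * real N"
    proof (intro add_mono sum_mono mult_left_mono N)
      fix t assume "t \<in> T"
      then show "x t * (real (f t) - c) \<le> max 0 (real (f t) - c)"
        using x[of t] mult_left_le_one_le[of "real (f t) - c" "x t"]
          mult_nonneg_nonpos[of "x t" "real (f t) - c"]
        by (cases "real (f t) \<ge> c") auto
    qed (simp add: c_def)
    also have "(\<Sum>t\<in>T. max 0 (real (f t) - c)) = sum_list (map (\<lambda>l. max 0 (real l - c)) L)"
      by (simp add: sum_L)
    also have "\<dots> = sum_list (map (\<lambda>l. max 0 (real l - c)) (take N L))
        + sum_list (map (\<lambda>l. max 0 (real l - c)) (drop N L))"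
      by (simp flip: sum_list_append map_append)
    \<comment> \<open>Positions start at 0, so \<open>L ! N\<close> is the first entry of
      \<open>drop N L\<close>. As \<open>L\<close> is descending, the positive parts vanish from
      there on and equal the plain differences before.\<close>
    also have "map (\<lambda>l. max 0 (real l - c)) (drop N L) = map (\<lambda>l. 0) (drop N L)"
      using desc[of N] by (intro map_cong) (auto simp: in_set_conv_nth c_def)
    also have "map (\<lambda>l. max 0 (real l - c)) (take N L) = map (\<lambda>l. real l - c) (take N L)"
      using desc[of _ N] False by (intro map_cong) (auto simp: in_set_conv_nth c_def)
    also have "sum_list (map (\<lambda>l. real l - c) (take N L)) = real (sum_list (take N L)) - c * real N"
      using False by (simp add: sum_list_subtractf sum_list_triv flip: sum_list_of_nat)
    finally show ?thesis by (simp add: L_def)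
  qed
qed

theorem mainTheorem1:
  fixes n r p :: nat and S :: "'a set" and \<M> :: "'a set list set"
  assumes "r \<ge> 1" and "p \<ge> 2"
    and "finite S" and "card S = n"
    and "\<M> \<subseteq> weak_compositions S p"
    and "\<And>k. 1 \<le> k \<Longrightarrow> k < p \<Longrightarrow> chain_free r (part k ` \<M>)"
  shows "(\<Sum>A\<in>\<M>. 1 / real (multinomial n (map card A))) \<le> real (r ^ (p - 1))
    \<and> card \<M> \<le> sum_largest_multinomials (r ^ (p - 1)) n p"
proof
  have p: "Suc (p - 1) = p" using assms(2) by simp
  have fin: "finite \<M>"
    by (rule finite_subset[OF assms(5) finite_weak_compositions[OF assms(3)]])
  \<comment> \<open>Part \<open>k\<close> sits at position \<open>k - 1\<close>, so the positions
    below \<open>p - 1\<close> are exactly the parts with \<open>1 \<le> k < p\<close>.\<close>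
  have "chain_free r ((\<lambda>A. A ! i) ` \<M>)" if "i < p - 1" for i
    using assms(6)[of "Suc i"] that by (simp add: part_def)
  then show a: "(\<Sum>A\<in>\<M>. 1 / real (multinomial n (map card A))) \<le> real (r ^ (p - 1))"
    using sum_inverse_multinomial_le[of S \<M> "p - 1" r] assms(3-5) p by simp
  define T where "T = weak_int_compositions n p"
  have finT: "finite T" by (simp add: T_def finite_weak_int_compositions)
  define \<M>' where "\<M>' as = {A \<in> \<M>. map card A = as}" for as
  define x where "x as = real (card (\<M>' as)) / real (multinomial n as)" for as
  have type: "map card ` \<M> \<subseteq> T"
    using map_card_in_weak_int_compositions assms(3-5) by (auto simp: T_def)
  have x_sum: "x as = (\<Sum>A\<in>\<M>' as. 1 / real (multinomial n (map card A)))" for as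
    by (simp add: x_def \<M>'_def)
  have "x as \<le> 1" for as
  proof -
    \<comment> \<open>All \<open>i\<close>-th parts within one type have size \<open>as ! i\<close>,
      and comparable finite sets of equal size coincide. Then (a) with \<open>r = 1\<close> bounds
      the fraction by a power of 1.\<close>
    have "chain_free 1 ((\<lambda>A. A ! i) ` \<M>' as)" if "i < p - 1" for i
    proof (rule chain_free_1_if_card_eq[where a = "as ! i"])
      fix B assume "B \<in> (\<lambda>A. A ! i) ` \<M>' as"
      then obtain A where A: "A \<in> \<M>" "map card A = as" "B = A ! i" by (auto simp: \<M>'_def)
      have "length A = p" "\<Union> (set A) = S"
        using A(1) assms(5) by (auto simp: weak_compositions_def)
      then have "i < length A" "B \<subseteq> S" using that A(3) by (auto intro: nth_mem)
      then show "finite B \<and> card B = as ! i"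
        using A assms(3) by (auto intro: finite_subset)
    qed
    then show ?thesis
      using sum_inverse_multinomial_le[of S "\<M>' as" "p - 1" 1] assms(3-5) p
      by (auto simp: x_sum \<M>'_def)
  qed
  \<comment> \<open>Grouping the sum in (a) by type yields exactly the sum of the fractions.\<close>
  moreover have "sum x T \<le> real (r ^ (p - 1))"
    using a sum.group[OF fin finT type, of "\<lambda>A. 1 / real (multinomial n (map card A))"]
    by (simp add: x_sum \<M>'_def)
  ultimately have "(\<Sum>as\<in>T. x as * real (multinomial n as))
      \<le> real (sum_largest_multinomials (r ^ (p - 1)) n p)"
    unfolding sum_largest_multinomials_def multinomials_desc_def T_def[symmetric]
    by (intro fractional_knapsack_le finT) (auto simp: x_def)
  \<comment> \<open>On \<open>T\<close> the multinomial coefficient is nonzero, so it cancels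
    against the denominator of \<open>x as\<close> and leaves the number of compositions of that
    type.\<close>
  moreover have "(\<Sum>as\<in>T. x as * real (multinomial n as)) = (\<Sum>as\<in>T. real (card (\<M>' as)))"
    by (intro sum.cong)
      (auto simp: x_def T_def weak_int_compositions_def multinomial_pos[THEN gr_implies_not0])
  moreover have "\<dots> = real (card \<M>)"
    using sum.group[OF fin finT type, of "\<lambda>_. 1::real"] by (simp add: \<M>'_def)
  ultimately show "card \<M> \<le> sum_largest_multinomials (r ^ (p - 1)) n p" by simp
qed

end
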